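(* Let $\mathcal{L}$ be a Riesz space and $\mathcal{M}$ a Dedekind complete Riesz space. Let $(R_n)$ be a sequence in $\mathcal{L}_b(\mathcal{L},\mathcal{M})$ and $R\in\mathcal{L}_b(\mathcal{L},\mathcal{M})$. Then $(R_n)$ is statistically order convergent to $R$ if and only if there exists a sequence $(T_n)$ in $\mathcal{L}_b(\mathcal{L},\mathcal{M})$ such that $(T_n)$ is order convergent to $R$ in $\mathcal{L}_b(\mathcal{L},\mathcal{M})$ and $\delta(\{n\in\mathbb{N}: R_n=T_n\})=1$.
   Context: All Riesz spaces (vector lattices) are real and Archimedean; $\theta$ denotes the zero element. "Operator" means linear map. An operator is order bounded if it maps order bounded sets to order bounded sets. $\mathcal{L}_b(\mathcal{L},\mathcal{M})$ is the space of order bounded operators $\mathcal{L}\to\mathcal{M}$, ordered by $S\le T$ iff $S(u)\le T(u)$ for all $u\in\mathcal{L}_+$. When $\mathcal{M}$ is Dedekind complete (every non-empty set bounded above has a supremum), $\mathcal{L}_b(\mathcal{L},\mathcal{M})$ is a Dedekind complete Riesz space; $|\cdot|$ is the modulus in it. A sequence $(u_n)$ in a Riesz space is order convergent to $u$ if there is a sequence $v_n\downarrow\theta$ (i.e. $(v_n)$ decreasing with $\inf_n v_n=\theta$) such that $|u_n-u|\le v_n$ for all $n\in\mathbb{N}$. The natural density of $J\subseteq\mathbb{N}$ is $\delta(J)=\lim_{n\to\infty}\frac1n|\{j\in J: j\le n\}|$, when the limit exists. A sequence $(S_n)$ in $\mathcal{L}_b(\mathcal{L},\mathcal{M})$ is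 statistically order decreasing to $S\in\mathcal{L}_b(\mathcal{L},\mathcal{M})$ if there is $J\subseteq\mathbb{N}$ with $\delta(J)=1$ such that $S_m\le S_j$ for all $j<m$ in $J$ and $\inf_{j\in J}S_j=S$ in $\mathcal{L}_b(\mathcal{L},\mathcal{M})$. A sequence $(R_n)$ in $\mathcal{L}_b(\mathcal{L},\mathcal{M})$ is statistically order convergent to $R\in\mathcal{L}_b(\mathcal{L},\mathcal{M})$ if there exist a sequence $(S_n)$ in $\mathcal{L}_b(\mathcal{L},\mathcal{M})$ statistically order decreasing to $\theta$ and a set $J\subseteq\mathbb{N}$ with $\delta(J)=1$ such that $|R_j-R|\le S_j$ for all $j\in J$. *)

theory Defs
  imports "HOL-Analysis.Analysis" "HOL-Library.Lattice_Algebras" "HOL-Library.Lub_Glb"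
begin

section \<open>Riesz spaces\<close>

class riesz_space = ordered_real_vector + lattice_ab_group_add_abs

class archimedean_riesz_space = riesz_space +
  assumes archimedean: "0 \<le> x \<Longrightarrow> (\<And>n::nat. real n *\<^sub>R x \<le> y) \<Longrightarrow> x = 0"

text \<open>The class \<^class>\<open>conditionally_complete_lattice\<close> says that \<^const>\<open>Sup\<close> (\<^const>\<open>Inf\<close>) of a
  non-empty set bounded above (below) is its supremum (infimum).\<close>

class dedekind_complete_riesz_space = riesz_space + conditionally_complete_lattice
begin

subclass archimedean_riesz_space
proof
  fix x y :: 'a
  assume x: "0 \<le> x" and le: "\<And>n::nat. real n *\<^sub>R x \<le> y"
  let ?A = "range (\<lambda>n::nat. real n *\<^sub>R x)"
  have bdd: "bdd_above ?A" using le by (auto intro: bdd_aboveI)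
  have "Sup ?A \<le> Sup ?A - x"
  proof (rule cSup_least)
    fix z assume "z \<in> ?A"
    then obtain n :: nat where z: "z = real n *\<^sub>R x" by auto
    have "real (Suc n) *\<^sub>R x \<le> Sup ?A" by (rule cSup_upper[OF _ bdd]) blast
    then show "z \<le> Sup ?A - x" by (simp add: z scaleR_add_left scaleR_one le_diff_eq add.commute)
  qed simp
  then have "x \<le> 0" by (simp add: le_diff_eq)
  with x show "x = 0" by (rule order.antisym[rotated])
qed

end

instance real :: dedekind_complete_riesz_space
  by standard (auto simp: abs_real_def sup_real_def)


section \<open>Order bounded operators\<close>

definition order_bounded :: "'a::order set \<Rightarrow> bool" where
  "order_bounded A \<longleftrightarrow> bdd_below A \<and> bdd_above A"

definition order_bounded_map :: "('a::order \<Rightarrow> 'b::order) \<Rightarrow> bool" where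
  "order_bounded_map f \<longleftrightarrow> (\<forall>A. order_bounded A \<longrightarrow> order_bounded (f ` A))"

lemma order_bounded_iff: "order_bounded A \<longleftrightarrow> (\<exists>a b. A \<subseteq> {a..b})"
  by (auto simp: order_bounded_def bdd_below_def bdd_above_def subset_iff)

lemma order_bounded_mapI:
  fixes f :: "'a::order \<Rightarrow> 'b::order"
  assumes "\<And>a b. \<exists>c d. \<forall>x\<in>{a..b}. f x \<in> {c..d}"
  shows "order_bounded_map f"
  unfolding order_bounded_map_def order_bounded_iff
proof (intro allI impI)
  fix A :: "'a set" assume "\<exists>a b. A \<subseteq> {a..b}"
  then obtain a b where ab: "A \<subseteq> {a..b}" by blast
  obtain c d where "\<forall>x\<in>{a..b}. f x \<in> {c..d}" using assms[of a b] by blast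
  with ab show "\<exists>c d. f ` A \<subseteq> {c..d}" by blast
qed

lemma order_bounded_mapD:
  fixes f :: "'a::order \<Rightarrow> 'b::order"
  assumes "order_bounded_map f"
  obtains c d where "\<And>x. a \<le> x \<Longrightarrow> x \<le> b \<Longrightarrow> c \<le> f x \<and> f x \<le> d"
proof -
  have "order_bounded {a..b}" unfolding order_bounded_iff by blast
  then have "order_bounded (f ` {a..b})" using assms by (simp add: order_bounded_map_def)
  then obtain c d where "f ` {a..b} \<subseteq> {c..d}" unfolding order_bounded_iff by blast
  then show thesis by (intro that[of c d]) (auto simp: subset_iff)
qed

lemma order_bounded_map_add:
  fixes f g :: "'a::order \<Rightarrow> 'b::ordered_ab_group_add"
  assumes "order_bounded_map f" "order_bounded_map g"
  shows "order_bounded_map (\<lambda>x. f x + g x)"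
proof (rule order_bounded_mapI)
  fix a b
  obtain c d where 1: "\<And>x. a \<le> x \<Longrightarrow> x \<le> b \<Longrightarrow> c \<le> f x \<and> f x \<le> d"
    using order_bounded_mapD[OF assms(1)] by blast
  obtain c' d' where 2: "\<And>x. a \<le> x \<Longrightarrow> x \<le> b \<Longrightarrow> c' \<le> g x \<and> g x \<le> d'"
    using order_bounded_mapD[OF assms(2)] by blast
  have "\<forall>x\<in>{a..b}. f x + g x \<in> {c + c'..d + d'}" using 1 2 by (auto intro!: add_mono)
  then show "\<exists>c d. \<forall>x\<in>{a..b}. f x + g x \<in> {c..d}" by blast
qed

lemma order_bounded_map_uminus:
  fixes f :: "'a::order \<Rightarrow> 'b::ordered_ab_group_add"
  assumes "order_bounded_map f"
  shows "order_bounded_map (\<lambda>x. - f x)"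
proof (rule order_bounded_mapI)
  fix a b
  obtain c d where 1: "\<And>x. a \<le> x \<Longrightarrow> x \<le> b \<Longrightarrow> c \<le> f x \<and> f x \<le> d"
    using order_bounded_mapD[OF assms(1)] by blast
  have "\<forall>x\<in>{a..b}. - f x \<in> {- d..- c}" using 1 by auto
  then show "\<exists>c d. \<forall>x\<in>{a..b}. - f x \<in> {c..d}" by blast
qed

lemma order_bounded_map_scaleR_nonneg:
  fixes f :: "'a::order \<Rightarrow> 'b::ordered_real_vector"
  assumes "order_bounded_map f" "0 \<le> r"
  shows "order_bounded_map (\<lambda>x. r *\<^sub>R f x)"
proof (rule order_bounded_mapI)
  fix a b
  obtain c d where 1: "\<And>x. a \<le> x \<Longrightarrow> x \<le> b \<Longrightarrow> c \<le> f x \<and> f x \<le> d"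
    using order_bounded_mapD[OF assms(1)] by blast
  have "\<forall>x\<in>{a..b}. r *\<^sub>R f x \<in> {r *\<^sub>R c..r *\<^sub>R d}"
    using 1 assms(2) by (auto intro!: scaleR_left_mono)
  then show "\<exists>c d. \<forall>x\<in>{a..b}. r *\<^sub>R f x \<in> {c..d}" by blast
qed

lemma order_bounded_map_scaleR:
  fixes f :: "'a::order \<Rightarrow> 'b::ordered_real_vector"
  assumes "order_bounded_map f"
  shows "order_bounded_map (\<lambda>x. r *\<^sub>R f x)"
proof (cases "0 \<le> r")
  case False
  then have "order_bounded_map (\<lambda>x. - ((- r) *\<^sub>R f x))"
    by (intro order_bounded_map_uminus order_bounded_map_scaleR_nonneg assms) simp
  then show ?thesis by simp
qed (rule order_bounded_map_scaleR_nonneg[OF assms])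

lemma order_bounded_map_zero: "order_bounded_map (\<lambda>x. 0::'b::ordered_ab_group_add)"
  by (rule order_bounded_mapI) (auto intro!: exI[of _ 0])

typedef (overloaded) ('a::riesz_space, 'b::riesz_space) order_bounded_operator =
  "{f :: 'a \<Rightarrow> 'b. linear f \<and> order_bounded_map f}"
  morphisms ob_apply Ob_operator
  using linear_zero order_bounded_map_zero by blast

setup_lifting type_definition_order_bounded_operator

lemma linear_ob_apply: "linear (ob_apply f)"
  and order_bounded_map_ob_apply: "order_bounded_map (ob_apply f)"
  using ob_apply[of f] by auto

lemma ob_apply_nonneg_eqI:
  assumes "\<And>u. 0 \<le> u \<Longrightarrow> ob_apply f u = ob_apply g u"
  shows "f = g"
proof -
  have "ob_apply f x = ob_apply g x" for x
  proof -
    have x: "x = pprt x - pprt (- x)" by (metis prts pprt_neg diff_minus_eq_add)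
    show ?thesis
      by (subst (1 2) x) (simp add: linear_diff[OF linear_ob_apply] assms)
  qed
  then show ?thesis by (simp add: ob_apply_inject[symmetric] fun_eq_iff)
qed

instantiation order_bounded_operator :: (riesz_space, riesz_space) ordered_real_vector
begin

lift_definition zero_order_bounded_operator :: "('a, 'b) order_bounded_operator" is "\<lambda>x. 0"
  by (auto intro: linear_zero order_bounded_map_zero)

lift_definition plus_order_bounded_operator ::
  "('a, 'b) order_bounded_operator \<Rightarrow> ('a, 'b) order_bounded_operator \<Rightarrow> ('a, 'b) order_bounded_operator"
  is "\<lambda>f g x. f x + g x"
  by (auto intro: linear_compose_add order_bounded_map_add)

lift_definition uminus_order_bounded_operator ::
  "('a, 'b) order_bounded_operator \<Rightarrow> ('a, 'b) order_bounded_operator"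
  is "\<lambda>f x. - f x"
  by (auto intro: linear_compose_neg order_bounded_map_uminus)

lift_definition minus_order_bounded_operator ::
  "('a, 'b) order_bounded_operator \<Rightarrow> ('a, 'b) order_bounded_operator \<Rightarrow> ('a, 'b) order_bounded_operator"
  is "\<lambda>f g x. f x - g x"
  using order_bounded_map_add[OF _ order_bounded_map_uminus]
  by (fastforce intro: linear_compose_sub)

lift_definition scaleR_order_bounded_operator ::
  "real \<Rightarrow> ('a, 'b) order_bounded_operator \<Rightarrow> ('a, 'b) order_bounded_operator"
  is "\<lambda>r f x. r *\<^sub>R f x"
  by (auto intro: linear_compose_scale_right order_bounded_map_scaleR)

definition less_eq_order_bounded_operator ::
  "('a, 'b) order_bounded_operator \<Rightarrow> ('a, 'b) order_bounded_operator \<Rightarrow> bool" where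
  "S \<le> T \<longleftrightarrow> (\<forall>u\<ge>0. ob_apply S u \<le> ob_apply T u)"

definition less_order_bounded_operator ::
  "('a, 'b) order_bounded_operator \<Rightarrow> ('a, 'b) order_bounded_operator \<Rightarrow> bool" where
  "less_order_bounded_operator S T \<longleftrightarrow> S \<le> T \<and> \<not> T \<le> S"

lemmas ob_apply_simps =
  zero_order_bounded_operator.rep_eq plus_order_bounded_operator.rep_eq
  uminus_order_bounded_operator.rep_eq minus_order_bounded_operator.rep_eq
  scaleR_order_bounded_operator.rep_eq

instance
proof
  fix f g h :: "('a, 'b) order_bounded_operator" and a b :: real
  show "f + g + h = f + (g + h)" "f + g = g + f" "0 + f = f" "- f + f = 0" "f - g = f + - g"
    "a *\<^sub>R (f + g) = a *\<^sub>R f + a *\<^sub>R g" "(a + b) *\<^sub>R f = a *\<^sub>R f + b *\<^sub>R f"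
    "a *\<^sub>R b *\<^sub>R f = (a * b) *\<^sub>R f" "1 *\<^sub>R f = f"
    by (transfer, simp add: fun_eq_iff algebra_simps)+
  show "f < g \<longleftrightarrow> f \<le> g \<and> \<not> g \<le> f" by (rule less_order_bounded_operator_def)
  show "f \<le> f" by (simp add: less_eq_order_bounded_operator_def)
  show "f \<le> h" if "f \<le> g" "g \<le> h"
    using that by (auto simp: less_eq_order_bounded_operator_def intro: order_trans)
  show "f = g" if "f \<le> g" "g \<le> f"
    using that by (intro ob_apply_nonneg_eqI antisym) (auto simp: less_eq_order_bounded_operator_def)
  show "h + f \<le> h + g" if "f \<le> g"
    using that by (auto simp: less_eq_order_bounded_operator_def ob_apply_simps)
  show "a *\<^sub>R f \<le> a *\<^sub>R g" if "f \<le> g" "0 \<le> a"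
    using that by (auto simp: less_eq_order_bounded_operator_def ob_apply_simps intro: scaleR_left_mono)
  show "a *\<^sub>R f \<le> b *\<^sub>R f" if "a \<le> b" "0 \<le> f"
    using that by (auto simp: less_eq_order_bounded_operator_def ob_apply_simps intro: scaleR_right_mono)
qed

end


section \<open>The Riesz--Kantorovich construction\<close>

text \<open>For \<open>u \<ge> 0\<close>, the positive part of \<open>f\<close> at \<open>u\<close> is the supremum of \<open>f v\<close> over \<open>0 \<le> v \<le> u\<close>;
  it extends to all of the domain by differences of positive elements.\<close>

definition rk_cone :: "('a::riesz_space \<Rightarrow> 'b::dedekind_complete_riesz_space) \<Rightarrow> 'a \<Rightarrow> 'b" where
  "rk_cone f u = (SUP v\<in>{0..u}. f v)"

definition rk_pos :: "('a::riesz_space \<Rightarrow> 'b::dedekind_complete_riesz_space) \<Rightarrow> 'a \<Rightarrow> 'b" where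
  "rk_pos f x = rk_cone f (pprt x) - rk_cone f (pprt (- x))"

context
  fixes f :: "'a::riesz_space \<Rightarrow> 'b::dedekind_complete_riesz_space"
  assumes lin: "linear f" and ob: "order_bounded_map f"
begin

lemma rk_cone_bdd: "bdd_above (f ` {0..u})"
proof -
  obtain c d where "\<And>x. 0 \<le> x \<Longrightarrow> x \<le> u \<Longrightarrow> c \<le> f x \<and> f x \<le> d"
    using order_bounded_mapD[OF ob] by blast
  then show ?thesis by (intro bdd_aboveI[of _ d]) auto
qed

lemma rk_cone_upper: "0 \<le> v \<Longrightarrow> v \<le> u \<Longrightarrow> f v \<le> rk_cone f u"
  unfolding rk_cone_def by (intro cSUP_upper rk_cone_bdd) auto

lemma rk_cone_least:
  "0 \<le> u \<Longrightarrow> (\<And>v. 0 \<le> v \<Longrightarrow> v \<le> u \<Longrightarrow> f v \<le> z) \<Longrightarrow> rk_cone f u \<le> z"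
  unfolding rk_cone_def by (intro cSUP_least) auto

lemma rk_cone_nonneg: "0 \<le> u \<Longrightarrow> 0 \<le> rk_cone f u"
  using rk_cone_upper[of 0 u] by (simp add: linear_0[OF lin])

lemma rk_cone_0 [simp]: "rk_cone f 0 = 0"
  by (rule antisym) (auto intro!: rk_cone_least rk_cone_nonneg dest: antisym simp: linear_0[OF lin])

lemma rk_cone_add:
  assumes u: "0 \<le> u" and v: "0 \<le> v"
  shows "rk_cone f (u + v) = rk_cone f u + rk_cone f v"
proof (rule antisym)
  show "rk_cone f (u + v) \<le> rk_cone f u + rk_cone f v"
  proof (rule rk_cone_least)
    fix w assume w: "0 \<le> w" "w \<le> u + v"
    have eq: "w - inf w u = sup 0 (w - u)" by (simp add: diff_inf_eq_sup add_sup_distrib_left)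
    have "w - inf w u \<le> v" unfolding eq using w v by (simp add: algebra_simps)
    then have 2: "f (w - inf w u) \<le> rk_cone f v"
      by (intro rk_cone_upper) (simp_all only: eq sup_ge1)
    have "f (inf w u) \<le> rk_cone f u" using w u by (intro rk_cone_upper) auto
    from add_mono[OF this 2] show "f w \<le> rk_cone f u + rk_cone f v"
      by (simp only: linear_diff[OF lin] add_diff_cancel_left' add_diff_eq)
  qed (use u v in simp)
  have "f x + f y \<le> rk_cone f (u + v)" if "0 \<le> x" "x \<le> u" "0 \<le> y" "y \<le> v" for x y
    using rk_cone_upper[of "x + y" "u + v"] that by (simp add: linear_add[OF lin] add_mono)
  then have "rk_cone f u \<le> rk_cone f (u + v) - f y" if "0 \<le> y" "y \<le> v" for y
    using that u by (intro rk_cone_least) (auto simp: le_diff_eq)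
  then have "rk_cone f v \<le> rk_cone f (u + v) - rk_cone f u"
    using v by (intro rk_cone_least) (auto simp: algebra_simps)
  then show "rk_cone f u + rk_cone f v \<le> rk_cone f (u + v)" by (simp add: algebra_simps)
qed

lemma rk_cone_scaleR_le:
  assumes c: "0 < c" and u: "0 \<le> u"
  shows "c *\<^sub>R rk_cone f u \<le> rk_cone f (c *\<^sub>R u)"
proof -
  have "rk_cone f u \<le> inverse c *\<^sub>R rk_cone f (c *\<^sub>R u)"
  proof (rule rk_cone_least[OF u])
    fix v assume "0 \<le> v" "v \<le> u"
    then have "f (c *\<^sub>R v) \<le> rk_cone f (c *\<^sub>R u)"
      using c by (intro rk_cone_upper scaleR_nonneg_nonneg scaleR_left_mono) auto
    then have "inverse c *\<^sub>R f (c *\<^sub>R v) \<le> inverse c *\<^sub>R rk_cone f (c *\<^sub>R u)"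
      using c by (intro scaleR_left_mono) auto
    then show "f v \<le> inverse c *\<^sub>R rk_cone f (c *\<^sub>R u)" using c by (simp add: linear_scale[OF lin])
  qed
  then have "c *\<^sub>R rk_cone f u \<le> c *\<^sub>R inverse c *\<^sub>R rk_cone f (c *\<^sub>R u)"
    using c by (intro scaleR_left_mono) auto
  then show ?thesis using c by simp
qed

lemma rk_cone_scaleR:
  assumes c: "0 \<le> c" and u: "0 \<le> u"
  shows "rk_cone f (c *\<^sub>R u) = c *\<^sub>R rk_cone f u"
proof (cases "c = 0")
  case False
  then have c: "0 < c" using c by simp
  have "inverse c *\<^sub>R rk_cone f (c *\<^sub>R u) \<le> rk_cone f (inverse c *\<^sub>R c *\<^sub>R u)"
    using c u by (intro rk_cone_scaleR_le scaleR_nonneg_nonneg) auto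
  then have "inverse c *\<^sub>R rk_cone f (c *\<^sub>R u) \<le> rk_cone f u" using c by simp
  then have "c *\<^sub>R inverse c *\<^sub>R rk_cone f (c *\<^sub>R u) \<le> c *\<^sub>R rk_cone f u"
    using c by (intro scaleR_left_mono) auto
  then have "rk_cone f (c *\<^sub>R u) \<le> c *\<^sub>R rk_cone f u" using c by simp
  then show ?thesis using rk_cone_scaleR_le[OF c u] by (rule antisym)
qed simp

lemma pprt_diff_pprt: "(x::'a) = pprt x - pprt (- x)"
  by (metis prts pprt_neg diff_minus_eq_add)

lemma rk_pos_diff:
  assumes "0 \<le> a" "0 \<le> b"
  shows "rk_pos f (a - b) = rk_cone f a - rk_cone f b"
proof -
  let ?x = "a - b"
  have "?x = pprt ?x - pprt (- ?x)" by (rule pprt_diff_pprt)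
  then have "pprt ?x + b = a + pprt (- ?x)" by (simp add: algebra_simps)
  then have "rk_cone f (pprt ?x) + rk_cone f b = rk_cone f a + rk_cone f (pprt (- ?x))"
    using assms by (metis rk_cone_add zero_le_pprt)
  then show ?thesis unfolding rk_pos_def by (simp add: algebra_simps)
qed

lemma rk_pos_nonneg_eq: "0 \<le> u \<Longrightarrow> rk_pos f u = rk_cone f u"
  using rk_pos_diff[of u 0] by simp

lemma linear_rk_pos: "linear (rk_pos f)"
proof (rule linearI)
  fix x y :: 'a and c :: real
  have "x + y = (pprt x + pprt y) - (pprt (- x) + pprt (- y))"
    using pprt_diff_pprt[of x] pprt_diff_pprt[of y] by (metis add_diff_add)
  then have "rk_pos f (x + y) =
      rk_cone f (pprt x + pprt y) - rk_cone f (pprt (- x) + pprt (- y))"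
    by (metis rk_pos_diff zero_le_pprt add_nonneg_nonneg)
  then show "rk_pos f (x + y) = rk_pos f x + rk_pos f y"
    by (simp add: rk_cone_add rk_pos_def)
  show "rk_pos f (c *\<^sub>R x) = c *\<^sub>R rk_pos f x"
  proof (cases "0 \<le> c")
    case True
    have "c *\<^sub>R x = c *\<^sub>R pprt x - c *\<^sub>R pprt (- x)"
      by (metis pprt_diff_pprt scaleR_diff_right)
    then have "rk_pos f (c *\<^sub>R x) = rk_cone f (c *\<^sub>R pprt x) - rk_cone f (c *\<^sub>R pprt (- x))"
      using True by (metis rk_pos_diff zero_le_pprt scaleR_nonneg_nonneg)
    then show ?thesis using True by (simp add: rk_cone_scaleR rk_pos_def scaleR_diff_right)
  next
    case False
    then have c: "0 \<le> - c" by simp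
    have "c *\<^sub>R x = c *\<^sub>R pprt x - c *\<^sub>R pprt (- x)"
      by (metis pprt_diff_pprt scaleR_diff_right)
    also have "\<dots> = (- c) *\<^sub>R pprt (- x) - (- c) *\<^sub>R pprt x" by simp
    finally have "rk_pos f (c *\<^sub>R x) =
        rk_cone f ((- c) *\<^sub>R pprt (- x)) - rk_cone f ((- c) *\<^sub>R pprt x)"
      using c by (metis rk_pos_diff zero_le_pprt scaleR_nonneg_nonneg)
    then show ?thesis
      by (simp add: rk_cone_scaleR[OF c] rk_pos_def scaleR_diff_right del: scaleR_minus_left)
         (simp add: algebra_simps)
  qed
qed

lemma rk_pos_mono:
  assumes "x \<le> y"
  shows "rk_pos f x \<le> rk_pos f y"
proof -
  have "0 \<le> rk_pos f (y - x)" using assms by (simp add: rk_pos_nonneg_eq rk_cone_nonneg)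
  then show ?thesis by (simp add: linear_diff[OF linear_rk_pos])
qed

lemma order_bounded_map_rk_pos: "order_bounded_map (rk_pos f)"
proof (rule order_bounded_mapI)
  fix a b :: 'a
  have "\<forall>x\<in>{a..b}. rk_pos f x \<in> {rk_pos f a..rk_pos f b}" by (auto intro: rk_pos_mono)
  then show "\<exists>c d. \<forall>x\<in>{a..b}. rk_pos f x \<in> {c..d}" by blast
qed

end

lift_definition ob_pos ::
  "('a::riesz_space, 'b::dedekind_complete_riesz_space) order_bounded_operator
    \<Rightarrow> ('a, 'b) order_bounded_operator"
  is rk_pos
  by (auto intro: linear_rk_pos order_bounded_map_rk_pos)

lemma ob_apply_ob_pos: "0 \<le> u \<Longrightarrow> ob_apply (ob_pos f) u = rk_cone (ob_apply f) u"
  by (simp add: ob_pos.rep_eq rk_pos_nonneg_eq[OF linear_ob_apply order_bounded_map_ob_apply])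

lemma ob_pos_nonneg: "0 \<le> ob_pos f"
  by (auto simp: less_eq_order_bounded_operator_def ob_apply_ob_pos ob_apply_simps
      intro: rk_cone_nonneg[OF linear_ob_apply order_bounded_map_ob_apply])

lemma ob_pos_upper: "f \<le> ob_pos f"
  by (auto simp: less_eq_order_bounded_operator_def ob_apply_ob_pos
      intro: rk_cone_upper[OF linear_ob_apply order_bounded_map_ob_apply])

lemma ob_pos_least:
  assumes "0 \<le> h" "f \<le> h"
  shows "ob_pos f \<le> h"
  unfolding less_eq_order_bounded_operator_def
proof (intro allI impI)
  fix u :: 'a assume u: "0 \<le> u"
  have "rk_cone (ob_apply f) u \<le> ob_apply h u"
  proof (rule rk_cone_least[OF linear_ob_apply order_bounded_map_ob_apply u])
    fix v assume v: "0 \<le> v" "v \<le> u"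
    have "ob_apply f v \<le> ob_apply h v"
      using assms v by (simp add: less_eq_order_bounded_operator_def)
    also have "0 \<le> ob_apply h (u - v)"
      using assms v by (simp add: less_eq_order_bounded_operator_def ob_apply_simps)
    then have "ob_apply h v \<le> ob_apply h u" by (simp add: linear_diff[OF linear_ob_apply])
    finally show "ob_apply f v \<le> ob_apply h u" .
  qed
  then show "ob_apply (ob_pos f) u \<le> ob_apply h u" by (simp add: ob_apply_ob_pos u)
qed

instantiation order_bounded_operator :: (riesz_space, dedekind_complete_riesz_space) riesz_space
begin

definition sup_order_bounded_operator ::
  "('a, 'b) order_bounded_operator \<Rightarrow> ('a, 'b) order_bounded_operator \<Rightarrow> ('a, 'b) order_bounded_operator"
  where "sup f g = g + ob_pos (f - g)"

definition inf_order_bounded_operator ::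
  "('a, 'b) order_bounded_operator \<Rightarrow> ('a, 'b) order_bounded_operator \<Rightarrow> ('a, 'b) order_bounded_operator"
  where "inf_order_bounded_operator f g = - sup (- f) (- g)"

definition abs_order_bounded_operator ::
  "('a, 'b) order_bounded_operator \<Rightarrow> ('a, 'b) order_bounded_operator"
  where "abs_order_bounded_operator f = sup f (- f)"

instance
proof
  fix f g h :: "('a, 'b) order_bounded_operator"
  have s1: "f \<le> sup f g" for f g :: "('a, 'b) order_bounded_operator"
    using ob_pos_upper[of "f - g"] by (simp add: sup_order_bounded_operator_def algebra_simps)
  have s2: "g \<le> sup f g" for f g :: "('a, 'b) order_bounded_operator"
    using ob_pos_nonneg[of "f - g"] by (simp add: sup_order_bounded_operator_def)
  have s3: "sup g h \<le> f" if "g \<le> f" "h \<le> f" for f g h :: "('a, 'b) order_bounded_operator"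
    using ob_pos_least[of "f - h" "g - h"] that
    by (simp add: sup_order_bounded_operator_def algebra_simps)
  show "f \<le> sup f g" "g \<le> sup f g" "g \<le> f \<Longrightarrow> h \<le> f \<Longrightarrow> sup g h \<le> f"
    by (fact s1 s2 s3)+
  show "inf f g \<le> f" "inf f g \<le> g"
    using s1[of "- f" "- g"] s2[of "- g" "- f"]
    by (simp_all add: inf_order_bounded_operator_def minus_le_iff)
  show "f \<le> inf g h" if "f \<le> g" "f \<le> h"
    using s3[of "- g" "- f" "- h"] that by (simp add: inf_order_bounded_operator_def le_minus_iff)
  show "\<bar>f\<bar> = sup f (- f)" by (rule abs_order_bounded_operator_def)
qed

end


section \<open>Order convergence and statistical order convergence\<close>

definition order_convergent :: "(nat \<Rightarrow> 'a::riesz_space) \<Rightarrow> 'a \<Rightarrow> bool" where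
  "order_convergent u l \<longleftrightarrow>
    (\<exists>v. decseq v \<and> isGlb UNIV (range v) 0 \<and> (\<forall>n. \<bar>u n - l\<bar> \<le> v n))"

text \<open>Whether \<open>0\<close> belongs to the set does not affect the density, so indexing sequences
  from \<open>0\<close> instead of \<open>1\<close> is harmless.\<close>

definition has_natural_density :: "nat set \<Rightarrow> real \<Rightarrow> bool" where
  "has_natural_density J d \<longleftrightarrow> (\<lambda>n. real (card {j \<in> J. j \<le> n}) / real n) \<longlonglongrightarrow> d"

definition statistically_order_decreasing :: "(nat \<Rightarrow> 'a::riesz_space) \<Rightarrow> 'a \<Rightarrow> bool" where
  "statistically_order_decreasing s l \<longleftrightarrow>
    (\<exists>J. has_natural_density J 1 \<and> (\<forall>j\<in>J. \<forall>m\<in>J. j < m \<longrightarrow> s m \<le> s j) \<and> isGlb UNIV (s ` J) l)"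

definition statistically_order_convergent :: "(nat \<Rightarrow> 'a::riesz_space) \<Rightarrow> 'a \<Rightarrow> bool" where
  "statistically_order_convergent r l \<longleftrightarrow>
    (\<exists>s J. statistically_order_decreasing s 0 \<and> has_natural_density J 1 \<and>
      (\<forall>j\<in>J. \<bar>r j - l\<bar> \<le> s j))"

end

theory Submission
  imports Defs
begin

text \<open>The equivalence holds in every Riesz space; the operator space is one because the codomain is
  Dedekind complete.

  An order convergent sequence that agrees with \<open>r\<close> on a set of density one is dominated there by
  its own regulator \<open>v\<close>, and \<open>v\<close> is statistically order decreasing with respect to the full index set.

  Conversely, intersect the index set on which the regulator \<open>s\<close> decreases with the one on which
  \<open>s\<close> dominates. The intersection \<open>I\<close> has density one
  (\<open>has_natural_density_1_Int\<close>), hence is infinite, hence cofinal in the naturals, and thus the infimum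
  of \<open>s\<close> along \<open>I\<close> is still \<open>0\<close>. Replacing \<open>r n\<close> by the limit off \<open>I\<close>, and \<open>s n\<close> by \<open>s\<close> at the
  next element of \<open>I\<close> at or after \<open>n\<close>, gives a sequence with a genuinely decreasing regulator whose
  set of values is \<open>s ` I\<close>.\<close>

lemma has_natural_density_UNIV: "has_natural_density UNIV 1"
proof -
  have "(\<lambda>n. real (Suc n) / real n) \<longlonglongrightarrow> 1" by (rule LIMSEQ_Suc_n_over_n)
  then show ?thesis by (simp add: has_natural_density_def atMost_def[symmetric])
qed

lemma has_natural_density_1_superset:
  assumes A: "has_natural_density A 1" and AB: "A \<subseteq> B"
  shows "has_natural_density B 1"
  unfolding has_natural_density_def
proof (rule tendsto_sandwich)
  show "(\<lambda>n. real (card {j \<in> A. j \<le> n}) / real n) \<longlonglongrightarrow> 1"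
    and "(\<lambda>n. real (card {j \<in> UNIV. j \<le> n}) / real n) \<longlonglongrightarrow> 1"
    using A has_natural_density_UNIV by (simp_all only: has_natural_density_def)
  have "card {j \<in> A. j \<le> n} \<le> card {j \<in> B. j \<le> n}"
    and "card {j \<in> B. j \<le> n} \<le> card {j \<in> UNIV. j \<le> n}" for n
    by (rule card_mono; use AB in auto)+
  then show "\<forall>\<^sub>F n in sequentially. real (card {j \<in> A. j \<le> n}) / real n \<le> real (card {j \<in> B. j \<le> n}) / real n"
    and "\<forall>\<^sub>F n in sequentially. real (card {j \<in> B. j \<le> n}) / real n \<le> real (card {j \<in> UNIV. j \<le> n}) / real n"
    by (simp_all only: always_eventually divide_right_mono of_nat_mono of_nat_0_le_iff simp_thms)
qed

text \<open>By inclusion--exclusion, since the union has density one as well.\<close>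

lemma has_natural_density_1_Int:
  assumes A: "has_natural_density A 1" and B: "has_natural_density B 1"
  shows "has_natural_density (A \<inter> B) 1"
proof -
  let ?c = "\<lambda>C n. real (card {j \<in> C. j \<le> n})"
  have "has_natural_density (A \<union> B) 1"
    using has_natural_density_1_superset[OF A] by blast
  then have "(\<lambda>n. ?c A n / real n + ?c B n / real n - ?c (A \<union> B) n / real n) \<longlonglongrightarrow> 1 + 1 - 1"
    using A B unfolding has_natural_density_def by (intro tendsto_intros)
  moreover have "?c A n / real n + ?c B n / real n - ?c (A \<union> B) n / real n = ?c (A \<inter> B) n / real n"
    for n
  proof -
    have "card {j \<in> A. j \<le> n} + card {j \<in> B. j \<le> n} =
        card ({j \<in> A. j \<le> n} \<union> {j \<in> B. j \<le> n}) + card ({j \<in> A. j \<le> n} \<inter> {j \<in> B. j \<le> n})"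
      by (rule card_Un_Int) auto
    also have "{j \<in> A. j \<le> n} \<union> {j \<in> B. j \<le> n} = {j \<in> A \<union> B. j \<le> n}" by auto
    also have "{j \<in> A. j \<le> n} \<inter> {j \<in> B. j \<le> n} = {j \<in> A \<inter> B. j \<le> n}" by auto
    finally have "?c A n + ?c B n = ?c (A \<union> B) n + ?c (A \<inter> B) n"
      by (simp only: of_nat_add[symmetric])
    then have "?c (A \<inter> B) n = ?c A n + ?c B n - ?c (A \<union> B) n" by simp
    then show ?thesis by (simp only: add_divide_distrib diff_divide_distrib)
  qed
  ultimately show ?thesis by (simp add: has_natural_density_def)
qed

lemma has_natural_density_finite:
  assumes "finite J"
  shows "has_natural_density J 0"
  unfolding has_natural_density_def
proof (rule tendsto_sandwich)
  show "(\<lambda>n. 0 :: real) \<longlonglongrightarrow> 0" by simp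
  show "(\<lambda>n. real (card J) / real n) \<longlonglongrightarrow> 0" by (rule lim_const_over_n)
  have "card {j \<in> J. j \<le> n} \<le> card J" for n using assms by (intro card_mono) auto
  then show "\<forall>\<^sub>F n in sequentially. real (card {j \<in> J. j \<le> n}) / real n \<le> real (card J) / real n"
    by (simp add: divide_right_mono)
qed simp

lemma has_natural_density_1_infinite:
  assumes "has_natural_density J 1"
  shows "infinite J"
proof
  assume "finite J"
  then have "has_natural_density J 0" by (rule has_natural_density_finite)
  with assms show False
    unfolding has_natural_density_def using LIMSEQ_unique by fastforce
qed

lemma order_convergent_imp_statistically_order_convergent:
  fixes r t :: "nat \<Rightarrow> 'a::riesz_space"
  assumes "order_convergent t l" and dens: "has_natural_density {n. r n = t n} 1"
  shows "statistically_order_convergent r l"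
proof -
  obtain v where v: "decseq v" "isGlb UNIV (range v) 0" "\<And>n. \<bar>t n - l\<bar> \<le> v n"
    using assms(1) by (auto simp: order_convergent_def)
  have "statistically_order_decreasing v 0"
    unfolding statistically_order_decreasing_def
    using has_natural_density_UNIV v(1,2) by (auto intro!: exI[of _ UNIV] intro: decseqD)
  moreover have "\<forall>j\<in>{n. r n = t n}. \<bar>r j - l\<bar> \<le> v j" using v(3) by simp
  ultimately show ?thesis
    using dens unfolding statistically_order_convergent_def by blast
qed

text \<open>A cofinal subfamily of a decreasing family has the same lower bounds.\<close>

lemma isGlb_decreasing_infinite_subset:
  fixes s :: "nat \<Rightarrow> 'a::order"
  assumes dec: "\<And>j m. j \<in> K \<Longrightarrow> m \<in> K \<Longrightarrow> j < m \<Longrightarrow> s m \<le> s j"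
    and glb: "isGlb UNIV (s ` K) l" and IK: "I \<subseteq> K" and inf: "infinite I"
  shows "isGlb UNIV (s ` I) l"
proof -
  have "isLb UNIV (s ` I) x \<longleftrightarrow> isLb UNIV (s ` K) x" for x
  proof
    assume x: "isLb UNIV (s ` I) x"
    have "x \<le> s k" if k: "k \<in> K" for k
    proof -
      obtain i where i: "i \<in> I" "k < i" using inf by (auto simp: infinite_nat_iff_unbounded)
      have "x \<le> s i" using x i by (simp add: isLb_def setge_def)
      also have "s i \<le> s k" using dec k i IK by blast
      finally show ?thesis .
    qed
    then show "isLb UNIV (s ` K) x" by (simp add: isLb_def setge_def)
  next
    assume "isLb UNIV (s ` K) x"
    then show "isLb UNIV (s ` I) x" using IK by (auto simp: isLb_def setge_def)
  qed
  then have "isLb UNIV (s ` I) = isLb UNIV (s ` K)" by blast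
  with glb show ?thesis by (simp add: isGlb_def)
qed

lemma statistically_order_convergent_imp_order_convergent:
  fixes r :: "nat \<Rightarrow> 'a::riesz_space"
  assumes "statistically_order_convergent r l"
  shows "\<exists>t. order_convergent t l \<and> has_natural_density {n. r n = t n} 1"
proof -
  obtain s J K where J: "has_natural_density J 1" and dom: "\<And>j. j \<in> J \<Longrightarrow> \<bar>r j - l\<bar> \<le> s j"
    and K: "has_natural_density K 1"
    and dec: "\<And>j m. j \<in> K \<Longrightarrow> m \<in> K \<Longrightarrow> j < m \<Longrightarrow> s m \<le> s j"
    and glb: "isGlb UNIV (s ` K) 0"
    using assms unfolding statistically_order_convergent_def statistically_order_decreasing_def
    by blast
  define I where "I = J \<inter> K"
  have dens: "has_natural_density I 1" unfolding I_def using J K by (rule has_natural_density_1_Int)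
  have inf: "infinite I" using dens by (rule has_natural_density_1_infinite)
  have glbI: "isGlb UNIV (s ` I) 0"
    using isGlb_decreasing_infinite_subset[OF dec glb _ inf] by (simp add: I_def)
  then have s_nonneg: "0 \<le> s i" if "i \<in> I" for i
    using that by (auto simp: isGlb_def isLb_def greatestP_def setge_def)

  define nxt where "nxt n = (LEAST i. i \<in> I \<and> n \<le> i)" for n
  have nxt: "nxt n \<in> I" "n \<le> nxt n" for n
  proof -
    have "\<exists>i. i \<in> I \<and> n \<le> i" using inf by (auto simp: infinite_nat_iff_unbounded_le)
    then have "nxt n \<in> I \<and> n \<le> nxt n" unfolding nxt_def by (rule LeastI_ex)
    then show "nxt n \<in> I" "n \<le> nxt n" by auto
  qed
  have nxt_le: "nxt n \<le> i" if "i \<in> I" "n \<le> i" for n i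
    unfolding nxt_def using that by (simp add: Least_le)
  have nxt_id: "nxt n = n" if "n \<in> I" for n
    using nxt_le[OF that] nxt(2) by (simp add: antisym)

  define t where "t n = (if n \<in> I then r n else l)" for n
  have "decseq (\<lambda>n. s (nxt n))"
  proof (rule monotone_onI)
    fix m n :: nat assume "m \<le> n"
    then have "nxt m \<le> nxt n" using nxt[of n] by (intro nxt_le) auto
    then show "s (nxt n) \<le> s (nxt m)"
      using dec[of "nxt m" "nxt n"] nxt by (cases "nxt m = nxt n") (auto simp: I_def)
  qed
  moreover have "range (\<lambda>n. s (nxt n)) = s ` I"
  proof (intro equalityI subsetI)
    fix x assume "x \<in> s ` I"
    then obtain i where "i \<in> I" "x = s i" by blast
    then have "x = s (nxt i)" by (simp add: nxt_id)
    then show "x \<in> range (\<lambda>n. s (nxt n))" by blast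
  qed (use nxt(1) in auto)
  moreover have "\<bar>t n - l\<bar> \<le> s (nxt n)" for n
  proof (cases "n \<in> I")
    case True
    then show ?thesis using dom by (simp add: t_def nxt_id I_def)
  next
    case False
    then show ?thesis using s_nonneg nxt(1) by (simp add: t_def)
  qed
  ultimately have "order_convergent t l"
    unfolding order_convergent_def using glbI by (intro exI[of _ "\<lambda>n. s (nxt n)"]) simp
  moreover have "has_natural_density {n. r n = t n} 1"
    by (rule has_natural_density_1_superset[OF dens]) (auto simp: t_def)
  ultimately show ?thesis by blast
qed

theorem theorem3p10:
  fixes R :: "nat \<Rightarrow> ('l::archimedean_riesz_space, 'm::dedekind_complete_riesz_space) order_bounded_operator"
    and R\<^sub>0 :: "('l, 'm) order_bounded_operator"
  shows "statistically_order_convergent R R\<^sub>0 \<longleftrightarrow>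
    (\<exists>T :: nat \<Rightarrow> ('l, 'm) order_bounded_operator.
      order_convergent T R\<^sub>0 \<and> has_natural_density {n. R n = T n} 1)"
  using statistically_order_convergent_imp_order_convergent
    order_convergent_imp_statistically_order_convergent by blast

end
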